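(* Suppose $Sp(1)\subset Sp(1)Sp(n)$ is such that $H\cong\Sigma^1$ and $E\cong\Sigma^m$ ($m\ge 1$) is irreducible, so that $T_xM_{\mathbb C}=\Sigma^1\otimes\Sigma^m$, and let $Q:\Sigma^1\otimes\Sigma^m\to\Sigma^2\otimes\Sigma^{m+1}$ and $\sigma:\Sigma^1\otimes\Sigma^m\to\Sigma^{m+1}$ be the maps defined in the context. Let $Y\in\Sigma^1\otimes\Sigma^m$ and write $Q(Y)=\sum_{i=1}^3 v_i\otimes p_i$ with $p_i\in\Sigma^{m+1}$, where $(v_1,v_2,v_3)$ is the basis of $\Sigma^2$ given by $v_i=I_i$. Then $$Q(I_1Y)=v_1\otimes\tfrac14\,\sigma(Y)+v_2\otimes p_3-v_3\otimes p_2 .$$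
   Context: $M$ is a quaternion-Kähler manifold with holonomy representation $T_xM_{\mathbb C}=H\otimes E$ of $Sp(1)Sp(n)$. $\Sigma^k=S^k(\Sigma^1)$ is the irreducible complex $Sp(1)$-representation of dimension $k+1$, realized as the symmetric tensors in $(\Sigma^1)^{\otimes k}$. $h,\hat h$ is a unitary basis of $H=\Sigma^1$ with $\omega_H(h,\hat h)=1$, and as a tensor $\omega_H=\frac12(h\hat h-\hat h h)$ (tensor product symbols omitted); $\imath=\sqrt{-1}$. For symmetric tensors $\alpha\in\Sigma^a$, $\beta\in\Sigma^b$, $\{\alpha\,\beta\}\in\Sigma^{a+b}$ denotes the full symmetrization of $\alpha\otimes\beta$, where the symmetrization map is $S(x_1\otimes\cdots\otimes x_r)=\frac1{r!}\sum_{\pi}x_{\pi(1)}\otimes\cdots\otimes x_{\pi(r)}$; e.g. $\{hh\}=hh$. The map $\sigma:\Sigma^1\otimes\Sigma^m\to\Sigma^{m+1}$ is this symmetrization $\sigma(\alpha\otimes\beta)=\{\alpha\beta\}$. The map $Q$ is obtained by tensoring with $\omega_H\in\Sigma^1\otimes\Sigma^1$ and symmetrizing the first factor of $\omega_H$ with the $\Sigma^1$ factor and the second factor of $\omega_H$ with the $\Sigma^m$ factor. Explicitly, for $Y=h\otimes\beta+\hat h\otimes\hat\beta$ with $\beta,\hat\beta\in\Sigma^m$, $$Q(Y)=\tfrac12\{hh\}\{\hat h\beta\}+\tfrac14(h\hat h+\hat hh)\bigl(\{\hat h\hat\beta\}-\{h\beta\}\bigr)-\tfrac12\{\hat h\hat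 h\}\{h\hat\beta\}\in\Sigma^2\otimes\Sigma^{m+1}.$$ The basis of $S^2H=\Sigma^2$ is $I_1=\imath(h\hat h+\hat hh)$, $I_2=hh+\hat h\hat h$, $I_3=\imath(hh-\hat h\hat h)$. These act on $H$ by contraction with $\omega_H$ (and trivially on $E$); in particular $I_1Y=-\imath h\otimes\beta+\imath\hat h\otimes\hat\beta$. *)

theory Defs
  imports Complex_Main "HOL-Library.Poly_Mapping" "HOL-Combinatorics.Permutations"
begin

text \<open>
  The standard representation \<open>H = \<Sigma>\<^sup>1\<close> is complex 2-space. Its standard coordinates are
  labelled by \<^typ>\<open>bool\<close>, a pure tensor of coordinate vectors is a word over \<^typ>\<open>bool\<close>, and the
  tensor algebra of \<open>H\<close> is the algebra of finite complex combinations of words: with concatenation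
  as addition of words, the product of finitely supported maps is the tensor product.
\<close>

instantiation list :: (type) monoid_add
begin

definition zero_list :: "'a list" where "0 = []"
definition plus_list :: "'a list \<Rightarrow> 'a list \<Rightarrow> 'a list" where "xs + ys = xs @ ys"

instance
  by standard (simp_all add: zero_list_def plus_list_def)

end

type_synonym tensor = "bool list \<Rightarrow>\<^sub>0 complex"

definition tscale :: "complex \<Rightarrow> tensor \<Rightarrow> tensor"  (infixr "*\<^sub>T" 75)
  where "c *\<^sub>T t = Poly_Mapping.map ((*) c) t"

lemma lookup_tscale [simp]: "Poly_Mapping.lookup (c *\<^sub>T t) w = c * Poly_Mapping.lookup t w"
  by (simp add: tscale_def map.rep_eq when_def)

interpretation tensor: vector_space tscale
  by standard (simp_all add: poly_mapping_eq_iff fun_eq_iff lookup_add algebra_simps)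

text \<open>Linear extension of a map given on words.\<close>

definition lin_ext :: "(bool list \<Rightarrow> tensor) \<Rightarrow> tensor \<Rightarrow> tensor"
  where "lin_ext f t = (\<Sum>w\<in>Poly_Mapping.keys t. Poly_Mapping.lookup t w *\<^sub>T f w)"

definition word :: "bool list \<Rightarrow> tensor"
  where "word w = Poly_Mapping.single w 1"

definition homogeneous :: "nat \<Rightarrow> tensor \<Rightarrow> bool"
  where "homogeneous k t \<longleftrightarrow> (\<forall>w\<in>Poly_Mapping.keys t. length w = k)"

definition Sig :: "nat \<Rightarrow> tensor set"  ("\<Sigma>")
  where "\<Sigma> k = {t. homogeneous k t \<and>
    (\<forall>\<pi> w. \<pi> permutes {..<k} \<longrightarrow> length w = k \<longrightarrow>
       Poly_Mapping.lookup t (permute_list \<pi> w) = Poly_Mapping.lookup t w)}"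

definition tensor_space :: "tensor set \<Rightarrow> tensor set \<Rightarrow> tensor set"  (infixr "\<Otimes>" 70)
  where "A \<Otimes> B = tensor.span {\<alpha> * \<beta> | \<alpha> \<beta>. \<alpha> \<in> A \<and> \<beta> \<in> B}"

text \<open>The full symmetrization of a tensor; degree by degree on the tensor algebra.\<close>

definition symmetrize :: "tensor \<Rightarrow> tensor"
  where "symmetrize = lin_ext (\<lambda>w. (1 / fact (length w)) *\<^sub>T
    (\<Sum>\<pi> | \<pi> permutes {..<length w}. word (permute_list \<pi> w)))"

definition coord :: "tensor \<Rightarrow> bool \<Rightarrow> complex"
  where "coord x i = Poly_Mapping.lookup x [i]"

definition hermitian :: "tensor \<Rightarrow> tensor \<Rightarrow> complex"
  where "hermitian x y = (\<Sum>i\<in>UNIV. coord x i * cnj (coord y i))"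

text \<open>The symplectic form on \<open>H\<close>, first on coordinate vectors.\<close>

definition eps :: "bool \<Rightarrow> bool \<Rightarrow> complex"
  where "eps i j = (if i = j then 0 else if j then 1 else - 1)"

definition omega :: "tensor \<Rightarrow> tensor \<Rightarrow> complex"
  where "omega x y = (\<Sum>i\<in>UNIV. \<Sum>j\<in>UNIV. eps i j * coord x i * coord y j)"

text \<open>
  In the basis-dependent definitions below \<open>h\<close>, \<open>h'\<close> is the basis usually written \<open>h\<close>, h-hat.
\<close>

definition unitary_basis :: "tensor \<Rightarrow> tensor \<Rightarrow> bool"
  where "unitary_basis h h' \<longleftrightarrow> h \<in> \<Sigma> 1 \<and> h' \<in> \<Sigma> 1 \<and>
    hermitian h h = 1 \<and> hermitian h' h' = 1 \<and> hermitian h h' = 0"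

definition omega_tensor :: "tensor \<Rightarrow> tensor \<Rightarrow> tensor"
  where "omega_tensor h h' = (1/2) *\<^sub>T (h * h' - h' * h)"

text \<open>
  On \<open>\<omega> * Y\<close> with \<open>\<omega>\<close> in \<open>\<Sigma> 1 \<Otimes> \<Sigma> 1\<close> and \<open>Y\<close> in \<open>\<Sigma> 1 \<Otimes> \<Sigma> m\<close>, the first factor \<open>a\<close> of \<open>\<omega>\<close> is
  symmetrized with the \<open>\<Sigma> 1\<close> factor \<open>x\<close> of \<open>Y\<close>, the second factor \<open>b\<close> with the \<open>\<Sigma> m\<close> factor \<open>u\<close>.
\<close>

definition Q_word :: "bool list \<Rightarrow> tensor"
  where "Q_word w = (case w of
    a # b # x # u \<Rightarrow> symmetrize (word [a, x]) * symmetrize (word (b # u)) | _ \<Rightarrow> 0)"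

definition Q :: "tensor \<Rightarrow> tensor \<Rightarrow> tensor \<Rightarrow> tensor"
  where "Q h h' Y = lin_ext Q_word (omega_tensor h h' * Y)"

definition sigma :: "tensor \<Rightarrow> tensor"
  where "sigma = symmetrize"

definition I1 :: "tensor \<Rightarrow> tensor \<Rightarrow> tensor"
  where "I1 h h' = \<i> *\<^sub>T (h * h' + h' * h)"

definition I2 :: "tensor \<Rightarrow> tensor \<Rightarrow> tensor"
  where "I2 h h' = h * h + h' * h'"

definition I3 :: "tensor \<Rightarrow> tensor \<Rightarrow> tensor"
  where "I3 h h' = \<i> *\<^sub>T (h * h - h' * h')"

text \<open>
  The action of \<open>J\<close> in \<open>\<Sigma> 2\<close> on the first factor of \<open>\<Sigma> 1 \<Otimes> \<Sigma> m\<close>: the second factor of \<open>J\<close> is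
  contracted with the \<open>\<Sigma> 1\<close> factor, \<open>(a \<otimes> b) \<cdot> x = \<omega>(b, x) a\<close>.
\<close>

definition contract_word :: "bool list \<Rightarrow> tensor"
  where "contract_word w = (case w of a # b # x # u \<Rightarrow> eps b x *\<^sub>T word (a # u) | _ \<Rightarrow> 0)"

definition act :: "tensor \<Rightarrow> tensor \<Rightarrow> tensor"
  where "act J Y = lin_ext contract_word (J * Y)"

lemma tscale_conv: "c *\<^sub>T t = Poly_Mapping.single 0 c * t"
  by (simp add: tscale_def mult_map_scale_conv_mult)

lemma tscale_mult_left: "(c *\<^sub>T s) * t = c *\<^sub>T (s * t)"
  by (simp add: tscale_conv mult.assoc)

lemma tensor_expand: "t = (\<Sum>w\<in>Poly_Mapping.keys t. Poly_Mapping.lookup t w *\<^sub>T word w)"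
  by (rule poly_mapping_eqI)
    (simp add: lookup_sum word_def lookup_single when_def in_keys_iff if_distrib cong: if_cong)

lemma tensor_induct [case_names zero word add]:
  assumes "P 0" "\<And>c w. P (c *\<^sub>T word w)" "\<And>s t. P s \<Longrightarrow> P t \<Longrightarrow> P (s + t)"
  shows "P t"
proof -
  have "P (\<Sum>w\<in>A. Poly_Mapping.lookup t w *\<^sub>T word w)" if "finite A" for A
    using that by (induction A) (auto intro: assms)
  then show ?thesis by (subst tensor_expand) simp
qed

lemma tscale_word: "c *\<^sub>T word w = Poly_Mapping.single w c"
  by (simp add: tscale_def word_def)

lemma tscale_mult_right: "s * (c *\<^sub>T t) = c *\<^sub>T (s * t)"
proof -
  have "s * Poly_Mapping.single 0 c = Poly_Mapping.single 0 c * s"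
    by (induction s rule: tensor_induct)
      (simp_all add: tscale_word mult_single algebra_simps zero_list_def plus_list_def)
  then show ?thesis by (metis tscale_conv mult.assoc)
qed

lemma lin_ext_alt:
  assumes "finite A" "Poly_Mapping.keys t \<subseteq> A"
  shows "lin_ext f t = (\<Sum>w\<in>A. Poly_Mapping.lookup t w *\<^sub>T f w)"
  unfolding lin_ext_def
  by (rule sum.mono_neutral_left) (use assms in \<open>auto simp: in_keys_iff\<close>)

lemma lin_ext_add: "lin_ext f (s + t) = lin_ext f s + lin_ext f t"
proof -
  let ?A = "Poly_Mapping.keys s \<union> Poly_Mapping.keys t"
  have "Poly_Mapping.keys (s + t) \<subseteq> ?A" by (rule Poly_Mapping.keys_add)
  then show ?thesis
    by (subst (1 2 3) lin_ext_alt[of ?A])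
       (auto simp: lookup_add tensor.scale_left_distrib sum.distrib)
qed

lemma lin_ext_scale: "lin_ext f (c *\<^sub>T t) = c *\<^sub>T lin_ext f t"
proof -
  have "Poly_Mapping.keys (c *\<^sub>T t) \<subseteq> Poly_Mapping.keys t" by (auto simp: in_keys_iff)
  then show ?thesis
    by (subst (1 2) lin_ext_alt[of "Poly_Mapping.keys t"]) (auto simp: tensor.scale_sum_right)
qed

lemma lin_ext_0: "lin_ext f 0 = 0" by (simp add: lin_ext_def)
lemma lin_ext_word: "lin_ext f (word w) = f w" by (simp add: lin_ext_def word_def)
lemma lin_ext_neg: "lin_ext f (-t) = - lin_ext f t"
  using lin_ext_scale[of f "-1" t] by simp
lemma lin_ext_diff: "lin_ext f (s - t) = lin_ext f s - lin_ext f t"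
  using lin_ext_add[of f s "-t"] lin_ext_neg[of f t] by simp

lemma word_mult: "word u * word v = word (u @ v)"
  by (simp add: word_def mult_single plus_list_def)

lemma homogeneous_1_cases:
  assumes "homogeneous 1 x"
  obtains a b where "x = a *\<^sub>T word [False] + b *\<^sub>T word [True]"
proof
  show "x = coord x False *\<^sub>T word [False] + coord x True *\<^sub>T word [True]"
  proof (rule poly_mapping_eqI)
    fix w
    show "Poly_Mapping.lookup x w = Poly_Mapping.lookup (coord x False *\<^sub>T word [False] + coord x True *\<^sub>T word [True]) w"
    proof (cases "w = [False] \<or> w = [True]")
      case True then show ?thesis by (auto simp: lookup_add coord_def word_def lookup_single)
    next
      case False
      then have "length w \<noteq> 1" by (cases w) auto
      then have "Poly_Mapping.lookup x w = 0" using assms by (auto simp: homogeneous_def in_keys_iff)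
      then show ?thesis using False by (auto simp: lookup_add coord_def word_def lookup_single when_def)
    qed
  qed
qed

lemma symmetrize_linear: "symmetrize (s + t) = symmetrize s + symmetrize t" "symmetrize (c *\<^sub>T s) = c *\<^sub>T symmetrize s"
  "symmetrize 0 = 0" "symmetrize (s - t) = symmetrize s - symmetrize t" "symmetrize (-t) = - symmetrize t"
  by (simp_all add: symmetrize_def lin_ext_add lin_ext_scale lin_ext_0 lin_ext_diff lin_ext_neg)

lemmas tensor_linear = lin_ext_add lin_ext_scale lin_ext_0 lin_ext_neg lin_ext_diff symmetrize_linear tscale_mult_left tscale_mult_right
  tensor.scale_right_distrib tensor.scale_left_distrib distrib_left distrib_right

lemma lin_ext_Q_word:
  assumes "homogeneous 1 a" "homogeneous 1 b" "homogeneous 1 x"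
  shows "lin_ext Q_word (a * b * (x * u)) = symmetrize (a * x) * symmetrize (b * u)"
proof -
  have 0: "lin_ext Q_word (word [a] * word [b] * (word [x] * u)) = symmetrize (word [a] * word [x]) * symmetrize (word [b] * u)" for a b x
    by (induction u rule: tensor_induct) (simp_all add: tensor_linear word_mult lin_ext_word Q_word_def)
  show ?thesis
    by (rule homogeneous_1_cases[OF assms(1)]; rule homogeneous_1_cases[OF assms(2)]; rule homogeneous_1_cases[OF assms(3)]; simp only: tensor_linear 0 tensor.scale_scale; simp add: ac_simps)
qed

lemma lin_ext_contract_word:
  assumes "homogeneous 1 a" "homogeneous 1 b" "homogeneous 1 x"
  shows "lin_ext contract_word (a * b * (x * u)) = omega b x *\<^sub>T (a * u)"
proof -
  have 0: "lin_ext contract_word (word [a] * word [b] * (word [x] * u)) = eps b x *\<^sub>T (word [a] * u)" for a b x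
    by (induction u rule: tensor_induct) (simp_all add: tensor_linear word_mult lin_ext_word contract_word_def tensor.scale_left_commute)
  show ?thesis
    by (rule homogeneous_1_cases[OF assms(1)]; rule homogeneous_1_cases[OF assms(2)]; rule homogeneous_1_cases[OF assms(3)]; 
     simp add: tensor_linear 0 tensor.scale_scale omega_def eps_def UNIV_bool coord_def lookup_add word_def[symmetric];
     simp add: word_def lookup_add lookup_single algebra_simps)
qed

lemma permutes_lessThan_2: "{p. p permutes {..<2::nat}} = {id, Transposition.transpose 0 1}"
proof -
  have "{..<2::nat} = {0,1}" by auto
  then show ?thesis by (auto simp: permutes_doubleton_iff)
qed

lemma symmetrize_two:
  assumes "homogeneous 1 a" "homogeneous 1 b"
  shows "symmetrize (a * b) = (1/2) *\<^sub>T (a * b + b * a)"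
proof -
  have 0: "symmetrize (word [a] * word [b]) = (1/2) *\<^sub>T (word [a] * word [b] + word [b] * word [a])" for a b
  proof -
    have ne: "id \<noteq> Transposition.transpose 0 (1::nat)"
      by (metis id_apply transpose_apply_first zero_neq_one)
    show ?thesis
      using ne by (simp add: symmetrize_def lin_ext_word word_mult permutes_lessThan_2[unfolded numeral_2_eq_2] permute_list_def)
  qed
  show ?thesis
    by (rule homogeneous_1_cases[OF assms(1)]; rule homogeneous_1_cases[OF assms(2)]; simp add: tensor_linear 0 mult.commute; simp add: algebra_simps)
qed

lemma omega_self: "omega x x = 0" and omega_swap: "omega x y = - omega y x"
  by (simp_all add: omega_def eps_def UNIV_bool)

text \<open>The explicit formulas for \<open>Q\<close> and for the action of \<open>I1\<close>.\<close>

lemma Q_explicit: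
  assumes "homogeneous 1 h" "homogeneous 1 h'"
  shows "Q h h' (h * \<beta> + h' * \<beta>') = (1/2) *\<^sub>T (h * h) * symmetrize (h' * \<beta>)
    + (1/4) *\<^sub>T (h * h' + h' * h) * (symmetrize (h' * \<beta>') - symmetrize (h * \<beta>))
    - (1/2) *\<^sub>T (h' * h') * symmetrize (h * \<beta>')"
  unfolding Q_def omega_tensor_def
  by (simp add: tensor_linear left_diff_distrib tensor.scale_right_diff_distrib lin_ext_Q_word symmetrize_two assms[simplified])
    (rule poly_mapping_eqI, simp add: algebra_simps tensor_linear lookup_add lookup_minus)

lemma act_I1_explicit:
  assumes "homogeneous 1 h" "homogeneous 1 h'" "omega h h' = 1"
  shows "act (I1 h h') (h * \<beta> + h' * \<beta>') = - \<i> *\<^sub>T (h * \<beta>) + \<i> *\<^sub>T (h' * \<beta>')"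
  unfolding act_def I1_def
  by (simp add: tensor_linear lin_ext_contract_word assms[simplified] omega_self omega_swap[of h' h])

end

theory Submission
  imports Defs
begin

text \<open>
  Write \<open>Y = h * \<beta> + h' * \<beta>'\<close>. In \<open>Q Y\<close> the tensor \<open>h * h\<close> of \<open>\<Sigma> 2\<close> carries \<open>\<beta>\<close> alone and
  \<open>h' * h'\<close> carries \<open>\<beta>'\<close> alone, while \<open>h * h' + h' * h\<close> carries the difference of the two
  symmetrizations \<open>{h' \<beta>'}\<close> and \<open>{h \<beta>}\<close>. Since \<open>I1\<close> multiplies \<open>\<beta>\<close> by \<open>-\<i>\<close> and \<open>\<beta>'\<close> by \<open>\<i>\<close>, in
  \<open>Q (I1 Y)\<close> the difference becomes \<open>\<i>\<close> times the sum, and the sum is \<open>\<sigma> Y\<close>. This is the \<open>I1\<close> term.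

  The other two terms come from the plane spanned by \<open>h * h\<close> and \<open>h' * h'\<close>. There \<open>I1\<close> multiplies
  the coefficient \<open>p2 + \<i> p3\<close> of \<open>h * h\<close> by \<open>-\<i>\<close> and the coefficient \<open>p2 - \<i> p3\<close> of \<open>h' * h'\<close> by
  \<open>\<i>\<close>, which is the rotation taking \<open>(p2, p3)\<close> to \<open>(p3, -p2)\<close>. To read these coefficients off the given
  expansion of \<open>Q Y\<close>, the first two tensor factors are contracted with \<open>h'\<close> or with \<open>h\<close>
  (lemma \<open>first_contract_mult\<close>): as \<open>\<omega>\<close> is alternating, contracting twice with \<open>h'\<close> leaves only the
  coefficient of \<open>h * h\<close>, and contracting twice with \<open>h\<close> only that of \<open>h' * h'\<close>.
\<close>

definition first_contract :: "tensor \<Rightarrow> tensor \<Rightarrow> tensor"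
  where "first_contract x = lin_ext (\<lambda>w. case w of i # u \<Rightarrow> omega x (word [i]) *\<^sub>T word u | [] \<Rightarrow> 0)"

lemma first_contract_linear:
  "first_contract x (s + t) = first_contract x s + first_contract x t"
  "first_contract x (s - t) = first_contract x s - first_contract x t"
  "first_contract x (- t) = - first_contract x t"
  "first_contract x (c *\<^sub>T t) = c *\<^sub>T first_contract x t"
  by (simp_all add: first_contract_def tensor_linear)

lemma omega_linear_right:
  "omega x (y + z) = omega x y + omega x z"
  "omega x (c *\<^sub>T y) = c * omega x y"
  by (simp_all add: omega_def coord_def lookup_add UNIV_bool algebra_simps)

lemma first_contract_mult:
  assumes "homogeneous 1 y"
  shows "first_contract x (y * u) = omega x y *\<^sub>T u"
proof -
  have word: "first_contract x (word [i] * u) = omega x (word [i]) *\<^sub>T u" for i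
    by (induction u rule: tensor_induct)
      (simp_all add: first_contract_def tensor_linear word_mult lin_ext_word tensor.scale_left_commute)
  obtain a b where "y = a *\<^sub>T word [False] + b *\<^sub>T word [True]"
    using homogeneous_1_cases[OF assms] .
  then show ?thesis
    by (simp add: tensor_linear first_contract_linear omega_linear_right word)
qed

text \<open>Cramer's rule: \<open>omega\<close> is the determinant of the coordinates.\<close>

lemma symplectic_basis_expansion:
  assumes "homogeneous 1 h" "homogeneous 1 h'" "homogeneous 1 x" "omega h h' = 1"
  shows "x = omega x h' *\<^sub>T h + omega h x *\<^sub>T h'"
proof -
  obtain a b where h: "h = a *\<^sub>T word [False] + b *\<^sub>T word [True]"
    using homogeneous_1_cases[OF assms(1)] .
  obtain c d where h': "h' = c *\<^sub>T word [False] + d *\<^sub>T word [True]"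
    using homogeneous_1_cases[OF assms(2)] .
  obtain e f where x: "x = e *\<^sub>T word [False] + f *\<^sub>T word [True]"
    using homogeneous_1_cases[OF assms(3)] .
  have det: "omega (a *\<^sub>T word [False] + b *\<^sub>T word [True]) (c *\<^sub>T word [False] + d *\<^sub>T word [True])
      = a * d - b * c" for a b c d
    by (simp add: omega_def eps_def UNIV_bool coord_def lookup_add word_def lookup_single)
  have "a * d - b * c = 1"
    using assms(4) by (simp add: h h' det)
  then have e: "(e * d - f * c) * a + (a * f - b * e) * c = e"
    and f: "(e * d - f * c) * b + (a * f - b * e) * d = f"
    by algebra+
  have "(e * d - f * c) *\<^sub>T h + (a * f - b * e) *\<^sub>T h'
      = ((e * d - f * c) * a + (a * f - b * e) * c) *\<^sub>T word [False]
      + ((e * d - f * c) * b + (a * f - b * e) * d) *\<^sub>T word [True]"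
    by (rule poly_mapping_eqI) (simp add: h h' lookup_add algebra_simps)
  also have "\<dots> = x"
    by (simp only: e f x)
  finally show ?thesis
    by (simp add: h h' x det)
qed

lemma tensor_space_expansion:
  assumes "homogeneous 1 h" "homogeneous 1 h'" "omega h h' = 1" "Y \<in> \<Sigma> 1 \<Otimes> B"
  obtains \<beta> \<beta>' where "Y = h * \<beta> + h' * \<beta>'"
proof -
  have "\<exists>\<beta> \<beta>'. Y = h * \<beta> + h' * \<beta>'"
    using assms(4) unfolding tensor_space_def
  proof (induction rule: tensor.span_induct_alt)
    case base
    have "0 = h * 0 + h' * 0" by simp
    then show ?case by blast
  next
    case (step c t s)
    then obtain \<alpha> \<gamma> \<beta> \<beta>' where t: "t = \<alpha> * \<gamma>" and "\<alpha> \<in> \<Sigma> 1" and s: "s = h * \<beta> + h' * \<beta>'"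
      by blast
    then have "homogeneous 1 \<alpha>"
      by (simp add: Sig_def)
    then have "\<alpha> * \<gamma> = (omega \<alpha> h' *\<^sub>T h + omega h \<alpha> *\<^sub>T h') * \<gamma>"
      using symplectic_basis_expansion assms(1-3) by metis
    then have "c *\<^sub>T t + s = h * (c *\<^sub>T omega \<alpha> h' *\<^sub>T \<gamma> + \<beta>) + h' * (c *\<^sub>T omega h \<alpha> *\<^sub>T \<gamma> + \<beta>')"
      by (simp add: t s tensor_linear algebra_simps)
    then show ?case by blast
  qed
  then show thesis using that by blast
qed

theorem proposition4p1:
  fixes m :: nat and h h' Y p1 p2 p3 :: tensor
  assumes "m \<ge> 1"
    and "unitary_basis h h'" and "omega h h' = 1"
    and "Y \<in> \<Sigma> 1 \<Otimes> \<Sigma> m"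
    and "p1 \<in> \<Sigma> (m + 1)" and "p2 \<in> \<Sigma> (m + 1)" and "p3 \<in> \<Sigma> (m + 1)"
    and "Q h h' Y = I1 h h' * p1 + I2 h h' * p2 + I3 h h' * p3"
  shows "Q h h' (act (I1 h h') Y) =
    I1 h h' * ((1/4) *\<^sub>T sigma Y) + I2 h h' * p3 - I3 h h' * p2"
proof -
  have h: "homogeneous 1 h" and h': "homogeneous 1 h'"
    using assms(2) by (auto simp: unitary_basis_def Sig_def)
  have \<omega>: "omega h h = 0" "omega h' h' = 0" "omega h h' = 1" "omega h' h = -1"
    using assms(3) omega_swap[of h' h] by (simp_all add: omega_self)
  obtain \<beta> \<beta>' where Y: "Y = h * \<beta> + h' * \<beta>'"
    using tensor_space_expansion[OF h h' assms(3,4)] .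
  note contract = first_contract_linear first_contract_mult[OF h] first_contract_mult[OF h'] \<omega>
  have expansion: "(1/2) *\<^sub>T (h * h) * symmetrize (h' * \<beta>)
    + (1/4) *\<^sub>T (h * h' + h' * h) * (symmetrize (h' * \<beta>') - symmetrize (h * \<beta>))
    - (1/2) *\<^sub>T (h' * h') * symmetrize (h * \<beta>') = I1 h h' * p1 + I2 h h' * p2 + I3 h h' * p3"
    using assms(8) by (simp only: Y Q_explicit[OF h h'])
  have double: "t = 2 *\<^sub>T s" if "(1/2) *\<^sub>T t = s" for s t
    by (simp flip: that)
  have A: "symmetrize (h' * \<beta>) = 2 *\<^sub>T (p2 + \<i> *\<^sub>T p3)"
    using arg_cong[OF expansion, of "\<lambda>t. first_contract h' (first_contract h' t)"]
    by (intro double) (simp add: I1_def I2_def I3_def tensor_linear ring_distribs mult.assoc contract)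
  have "- ((1/2) *\<^sub>T symmetrize (h * \<beta>')) = p2 - \<i> *\<^sub>T p3"
    using arg_cong[OF expansion, of "\<lambda>t. first_contract h (first_contract h t)"]
    by (simp add: I1_def I2_def I3_def tensor_linear ring_distribs mult.assoc contract)
  then have B: "symmetrize (h * \<beta>') = 2 *\<^sub>T (\<i> *\<^sub>T p3 - p2)"
    by (intro double) (simp add: minus_equation_iff[of _ "p2 - _"])
  have "act (I1 h h') Y = h * (- \<i> *\<^sub>T \<beta>) + h' * (\<i> *\<^sub>T \<beta>')"
    by (simp add: Y act_I1_explicit[OF h h' assms(3)] tensor_linear)
  then have "Q h h' (act (I1 h h') Y) = - (\<i>/2) *\<^sub>T (h * h) * symmetrize (h' * \<beta>)
    + (\<i>/4) *\<^sub>T (h * h' + h' * h) * (symmetrize (h' * \<beta>') + symmetrize (h * \<beta>))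
    - (\<i>/2) *\<^sub>T (h' * h') * symmetrize (h * \<beta>')"
    by (simp only: Q_explicit[OF h h'])
      (rule poly_mapping_eqI, simp add: algebra_simps tensor_linear lookup_add lookup_minus)
  also have "\<dots> = I1 h h' * ((1/4) *\<^sub>T sigma Y) + I2 h h' * p3 - I3 h h' * p2"
    unfolding A B
    by (rule poly_mapping_eqI)
      (simp add: Y sigma_def I1_def I2_def I3_def tensor_linear ring_distribs
        tensor.scale_right_diff_distrib lookup_add lookup_minus algebra_simps)
  finally show ?thesis .
qed

end
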